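(* Let $(a_0(n))_n$ and $(a_1(n))_n$ be real sequences with $2a_0(n)+a_1(n)=1$ for all $n$, and let $K_n^{M,1}$ be the associated modified Kantorovich operators. Then for every $f\in C[0,1]$, every $x\in[0,1]$ and every integer $n\ge1$, $$|K_n^{M,1}(f;x)-f(x)|\le|K_n(f;x)-f(x)|+\left|(1+a_1(n))\left(\tfrac12-x\right)\right|\,\omega_1\!\left(f;\tfrac1{n+1}\right).$$
   Context: Bernstein basis: $p_{n,k}(x)=\binom nk x^k(1-x)^{n-k}$ for $0\le k\le n$, $x\in[0,1]$ (with $0^0=1$), and $p_{n,k}=0$ if $k<0$ or $k>n$. Classical Kantorovich operator: $K_n(f;x)=(n+1)\sum_{k=0}^n p_{n,k}(x)\int_{k/(n+1)}^{(k+1)/(n+1)}f(t)\,dt$. Modified basis: given real sequences $a_0(n),a_1(n)$, put $a(x,n)=a_1(n)x+a_0(n)$ and, for $0\le k\le n$, $$p_{n,k}^{M,1}(x)=a(x,n)\,p_{n-1,k}(x)+a(1-x,n)\,p_{n-1,k-1}(x).$$ Modified Kantorovich operator: $K_n^{M,1}(f;x)=(n+1)\sum_{k=0}^n p_{n,k}^{M,1}(x)\int_{k/(n+1)}^{(k+1)/(n+1)}f(t)\,dt$. (No positivity is assumed.) $\omega_1(f;\delta)=\sup\{|f(s)-f(t)|: s,t\in[0,1],\ |s-t|\le\delta\}$. *)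

theory Defs
  imports "HOL-Analysis.Analysis"
begin

text \<open>
  \<^term>\<open>Bernstein\<close> only takes natural indices. Here the index is an integer, so that
  the index \<open>k - 1\<close> with \<open>k = 0\<close> is genuinely negative and gives \<open>0\<close>, instead of being
  truncated to \<open>0\<close>.
\<close>

definition bernstein_basis :: "nat \<Rightarrow> int \<Rightarrow> real \<Rightarrow> real" where
  "bernstein_basis n k x = (if 0 \<le> k \<and> k \<le> int n then Bernstein n (nat k) x else 0)"

definition kantorovich :: "nat \<Rightarrow> (real \<Rightarrow> real) \<Rightarrow> real \<Rightarrow> real" where
  "kantorovich n f x =
     (real n + 1) * (\<Sum>k = 0..n. bernstein_basis n (int k) x *
        integral {real k / (real n + 1) .. (real k + 1) / (real n + 1)} f)"

definition mod_coeff :: "(nat \<Rightarrow> real) \<Rightarrow> (nat \<Rightarrow> real) \<Rightarrow> real \<Rightarrow> nat \<Rightarrow> real" where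
  "mod_coeff a0 a1 x n = a1 n * x + a0 n"

text \<open>
  The following two definitions are meaningful only for \<open>n \<ge> 1\<close>, because \<open>n - 1\<close> is
  truncated at \<open>n = 0\<close>.
\<close>

definition mod_basis ::
  "(nat \<Rightarrow> real) \<Rightarrow> (nat \<Rightarrow> real) \<Rightarrow> nat \<Rightarrow> int \<Rightarrow> real \<Rightarrow> real" where
  "mod_basis a0 a1 n k x =
     mod_coeff a0 a1 x n * bernstein_basis (n - 1) k x +
     mod_coeff a0 a1 (1 - x) n * bernstein_basis (n - 1) (k - 1) x"

definition mod_kantorovich ::
  "(nat \<Rightarrow> real) \<Rightarrow> (nat \<Rightarrow> real) \<Rightarrow> nat \<Rightarrow> (real \<Rightarrow> real) \<Rightarrow> real \<Rightarrow> real" where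
  "mod_kantorovich a0 a1 n f x =
     (real n + 1) * (\<Sum>k = 0..n. mod_basis a0 a1 n (int k) x *
        integral {real k / (real n + 1) .. (real k + 1) / (real n + 1)} f)"

text \<open>
  The supremum is taken in \<^typ>\<open>real\<close>, so it has its usual meaning only for \<open>f\<close> bounded on
  \<open>[0,1]\<close> (in particular for \<open>f\<close> continuous there) and \<open>\<delta> \<ge> 0\<close>.
\<close>

definition modulus_of_continuity :: "(real \<Rightarrow> real) \<Rightarrow> real \<Rightarrow> real" where
  "modulus_of_continuity f \<delta> =
     Sup {\<bar>f s - f t\<bar> | s t. s \<in> {0..1} \<and> t \<in> {0..1} \<and> \<bar>s - t\<bar> \<le> \<delta>}"

end

theory Submission
  imports Defs
begin

text \<open>
  Pascal's rule for the Bernstein basis and the condition \<open>2 a\<^sub>0 + a\<^sub>1 = 1\<close> give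
  \<open>p\<^sup>M\<^sub>n\<^sub>,\<^sub>k - p\<^sub>n\<^sub>,\<^sub>k = (1 + a\<^sub>1)(1/2 - x)(p\<^sub>n\<^sub>-\<^sub>1\<^sub>,\<^sub>k\<^sub>-\<^sub>1 - p\<^sub>n\<^sub>-\<^sub>1\<^sub>,\<^sub>k)\<close>.
  Summation by parts turns the difference of the two operators into \<open>(1 + a\<^sub>1)(1/2 - x)\<close> times an
  average, with weights
  \<open>p\<^sub>n\<^sub>-\<^sub>1\<^sub>,\<^sub>k\<close>, of differences of the means of \<open>f\<close> over adjacent cells of length \<open>1/(n + 1)\<close>,
  and each of these is at most the modulus of continuity.
\<close>

lemma bernstein_basis_pascal:
  "bernstein_basis (Suc m) (int k) x =
     (1 - x) * bernstein_basis m (int k) x + x * bernstein_basis m (int k - 1) x"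
proof (cases k)
  case 0
  then show ?thesis
    by (simp add: bernstein_basis_def Bernstein_def)
next
  case (Suc j)
  show ?thesis
  proof (cases "Suc j \<le> m")
    case True
    \<comment> \<open>With this form of \<open>m\<close> the exponents of \<open>1 - x\<close>
      become \<open>d\<close> or \<open>Suc d\<close>, so truncated subtraction disappears and
      Pascal's rule for binomial coefficients finishes the case.\<close>
    then obtain d where d: "m = Suc (j + d)"
      by (metis less_iff_Suc_add Suc_le_eq)
    have n: "nat (1 + int j) = Suc j" by simp
    show ?thesis
      unfolding Suc d bernstein_basis_def Bernstein_def
      by (simp add: n algebra_simps)
  next
    \<comment> \<open>At \<open>k = m + 1\<close> only the term with index \<open>k - 1\<close>
      survives, giving \<open>x ^ Suc m\<close> on both sides; beyond that everything
      vanishes.\<close>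
    case False
    have n: "nat (1 + int j) = Suc j" by simp
    from False Suc show ?thesis
      by (auto simp: n bernstein_basis_def Bernstein_def)
  qed
qed

text \<open>Once \<open>a0\<close> is eliminated, the two coefficients of \<open>mod_basis\<close>
  differ from the Pascal coefficients \<open>1 - x\<close> and \<open>x\<close> by opposite
  amounts.\<close>

lemma mod_basis_minus_bernstein_basis:
  assumes "2 * a0 (Suc m) + a1 (Suc m) = 1"
  shows "mod_basis a0 a1 (Suc m) (int k) x - bernstein_basis (Suc m) (int k) x =
    (1 + a1 (Suc m)) * (1 / 2 - x) *
      (bernstein_basis m (int k - 1) x - bernstein_basis m (int k) x)"
proof -
  have a0: "a0 (Suc m) = (1 - a1 (Suc m)) / 2"
    using assms by simp
  show ?thesis
    unfolding bernstein_basis_pascal mod_basis_def mod_coeff_def a0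
    by (simp add: field_simps)
qed

lemma sum_bernstein_basis_diff:
  "(\<Sum>k = 0..Suc m. (bernstein_basis m (int k - 1) x - bernstein_basis m (int k) x) * c k) =
    (\<Sum>k\<le>m. Bernstein m k x * (c (Suc k) - c k))"
proof -
  \<comment> \<open>The term \<open>k = 0\<close> has index -1 and vanishes, which permits the
    shift; in the unshifted sum below the top term \<open>k = Suc m\<close> vanishes
    instead.\<close>
  have "(\<Sum>k = 0..Suc m. bernstein_basis m (int k - 1) x * c k) =
      (\<Sum>k\<le>m. Bernstein m k x * c (Suc k))"
    unfolding atLeast0AtMost sum.atMost_Suc_shift
    by (simp add: bernstein_basis_def)
  moreover have "(\<Sum>k = 0..Suc m. bernstein_basis m (int k) x * c k) =
      (\<Sum>k\<le>m. Bernstein m k x * c k)"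
    unfolding atLeast0AtMost sum.atMost_Suc
    by (simp add: bernstein_basis_def)
  ultimately show ?thesis
    by (simp only: left_diff_distrib right_diff_distrib sum_subtractf)
qed

lemma abs_diff_le_modulus_of_continuity:
  assumes f: "continuous_on {0..1} f"
    and "s \<in> {0..1}" "t \<in> {0..1}" "\<bar>s - t\<bar> \<le> \<delta>"
  shows "\<bar>f s - f t\<bar> \<le> modulus_of_continuity f \<delta>"
proof -
  \<comment> \<open>A real \<open>Sup\<close> is known to dominate its set only when that set is
    bounded above; compactness supplies the bound.\<close>
  have "bounded (f ` {0..1})"
    using f compact_continuous_image compact_imp_bounded by blast
  then obtain B where B: "\<And>u. u \<in> {0..1} \<Longrightarrow> \<bar>f u\<bar> \<le> B"
    unfolding bounded_iff by (metis image_eqI real_norm_def)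
  have "bdd_above {\<bar>f s - f t\<bar> | s t. s \<in> {0..1} \<and> t \<in> {0..1} \<and> \<bar>s - t\<bar> \<le> \<delta>}"
  proof (rule bdd_aboveI)
    fix y assume "y \<in> {\<bar>f s - f t\<bar> | s t. s \<in> {0..1} \<and> t \<in> {0..1} \<and> \<bar>s - t\<bar> \<le> \<delta>}"
    then obtain u v where "y = \<bar>f u - f v\<bar>" "u \<in> {0..1}" "v \<in> {0..1}"
      by blast
    with B[of u] B[of v] show "y \<le> 2 * B"
      by linarith
  qed
  then show ?thesis
    unfolding modulus_of_continuity_def using assms(2-4) by (intro cSup_upper) blast
qed

text \<open>Translating by \<open>h\<close> brings both integrals onto \<open>{a..b}\<close>, where
  the integrands differ pointwise by at most the modulus.\<close>

lemma integral_shift_diff_le_modulus: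
  assumes f: "continuous_on {0..1} f"
    and "0 \<le> a" "a \<le> b" "0 \<le> h" "b + h \<le> 1"
  shows "\<bar>integral {a + h..b + h} f - integral {a..b} f\<bar> \<le> (b - a) * modulus_of_continuity f h"
proof -
  have c1: "continuous_on {a + h..b + h} f" and c2: "continuous_on {a..b} f"
    by (rule continuous_on_subset[OF f]; use assms in auto)+
  have c3: "continuous_on {a..b} (\<lambda>t. f (t + h))"
    by (rule continuous_on_compose2[OF c1]) (auto intro!: continuous_intros)
  have "integral {a + h..b + h} f - integral {a..b} f = integral {a..b} (\<lambda>t. f (t + h) - f t)"
    using integral_shift[OF c1] c2 c3
    by (simp add: o_def integral_diff integrable_continuous_real)
  moreover have "norm (integral {a..b} (\<lambda>t. f (t + h) - f t)) \<le> modulus_of_continuity f h * (b - a)"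
  proof (rule integral_bound)
    show "continuous_on {a..b} (\<lambda>t. f (t + h) - f t)"
      using c2 c3 by (rule continuous_on_diff[rotated])
    show "norm (f (t + h) - f t) \<le> modulus_of_continuity f h" if "t \<in> {a..b}" for t
      using abs_diff_le_modulus_of_continuity[OF f, of "t + h" t h] assms that by simp
  qed (use assms in auto)
  ultimately show ?thesis
    by (simp add: mult.commute)
qed

lemma mod_kantorovich_minus_kantorovich_le:
  assumes a: "2 * a0 n + a1 n = 1"
    and f: "continuous_on {0..1} f"
    and x: "x \<in> {0..1}"
    and "n \<ge> 1"
  shows "\<bar>mod_kantorovich a0 a1 n f x - kantorovich n f x\<bar>
    \<le> \<bar>(1 + a1 n) * (1 / 2 - x)\<bar> * modulus_of_continuity f (1 / (real n + 1))"
proof -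
  obtain m where n: "n = Suc m"
    using \<open>n \<ge> 1\<close> by (cases n) auto
  define I where "I k = integral {real k / (real n + 1) .. (real k + 1) / (real n + 1)} f" for k
  define w where "w = modulus_of_continuity f (1 / (real n + 1))"
  define c where "c = (1 + a1 n) * (1 / 2 - x)"
  have "mod_kantorovich a0 a1 n f x - kantorovich n f x =
      (real n + 1) * (\<Sum>k = 0..n. (mod_basis a0 a1 n (int k) x - bernstein_basis n (int k) x) * I k)"
    unfolding mod_kantorovich_def kantorovich_def I_def
    by (simp only: left_diff_distrib right_diff_distrib sum_subtractf)
  also have "\<dots> = (real n + 1) * (\<Sum>k = 0..n.
      c * ((bernstein_basis m (int k - 1) x - bernstein_basis m (int k) x) * I k))"
    using a mod_basis_minus_bernstein_basis[of a0 m a1 _ x]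
    unfolding n c_def by (simp only: mult.assoc)
  also have "\<dots> = c * ((real n + 1) * (\<Sum>k\<le>m. Bernstein m k x * (I (Suc k) - I k)))"
    unfolding sum_distrib_left[symmetric] n sum_bernstein_basis_diff by simp
  finally have diff: "mod_kantorovich a0 a1 n f x - kantorovich n f x =
      c * ((real n + 1) * (\<Sum>k\<le>m. Bernstein m k x * (I (Suc k) - I k)))" .
  \<comment> \<open>Cell \<open>Suc k\<close> is cell \<open>k\<close> moved by
    \<open>1 / (real n + 1)\<close>; since \<open>k < n\<close>, its right end
    \<open>(k + 2) / (n + 1)\<close> stays within [0,1].\<close>
  have I: "\<bar>I (Suc k) - I k\<bar> \<le> w / (real n + 1)" if "k \<le> m" for k
  proof -
    have "\<bar>integral {real k / (real n + 1) + 1 / (real n + 1) ..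
          (real k + 1) / (real n + 1) + 1 / (real n + 1)} f -
        integral {real k / (real n + 1) .. (real k + 1) / (real n + 1)} f\<bar>
      \<le> ((real k + 1) / (real n + 1) - real k / (real n + 1)) * w"
      unfolding w_def
      by (rule integral_shift_diff_le_modulus[OF f])
        (use that n in \<open>auto simp: divide_simps\<close>)
    then show ?thesis
      by (simp add: I_def add_divide_distrib[symmetric] diff_divide_distrib[symmetric] add.commute)
  qed
  \<comment> \<open>On [0,1] the Bernstein weights are nonnegative with sum 1, so the bound for one
    difference carries over to the average.\<close>
  have "\<bar>\<Sum>k\<le>m. Bernstein m k x * (I (Suc k) - I k)\<bar>
      \<le> (\<Sum>k\<le>m. Bernstein m k x * (w / (real n + 1)))"
    using x I
    by (intro order.trans[OF sum_abs] sum_mono)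
      (simp add: abs_mult Bernstein_nonneg mult_left_mono del: times_divide_eq_right)
  also have "\<dots> = w / (real n + 1)"
    by (simp only: sum_distrib_right[symmetric] sum_Bernstein mult_1)
  finally have "(real n + 1) * \<bar>\<Sum>k\<le>m. Bernstein m k x * (I (Suc k) - I k)\<bar> \<le> w"
    by (simp add: field_simps)
  then have "\<bar>c\<bar> * ((real n + 1) * \<bar>\<Sum>k\<le>m. Bernstein m k x * (I (Suc k) - I k)\<bar>) \<le> \<bar>c\<bar> * w"
    by (rule mult_left_mono) simp
  then show ?thesis
    unfolding diff w_def[symmetric] c_def[symmetric] by (simp add: abs_mult)
qed

theorem theorem6p2:
  fixes a0 a1 :: "nat \<Rightarrow> real" and f :: "real \<Rightarrow> real" and x :: real and n :: nat
  assumes "\<And>m. m \<ge> 1 \<Longrightarrow> 2 * a0 m + a1 m = 1"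
    and "continuous_on {0..1} f"
    and "x \<in> {0..1}"
    and "n \<ge> 1"
  shows "\<bar>mod_kantorovich a0 a1 n f x - f x\<bar>
    \<le> \<bar>kantorovich n f x - f x\<bar>
      + \<bar>(1 + a1 n) * (1 / 2 - x)\<bar> * modulus_of_continuity f (1 / (real n + 1))"
  \<comment> \<open>Triangle inequality through \<open>kantorovich n f x\<close>.\<close>
  using mod_kantorovich_minus_kantorovich_le[of a0 n a1 f x] assms by fastforce

end
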